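(* Let $G$ and $H$ be non-trivial graphs, and let $T$ and $T'$ be spanning trees of $G$ and $H$, respectively. Then $DD_{\mathrm{m}}(G \,\square\, H) \leq DD_{\mathrm{m}}(T \,\square\, T')$.
   Context: Graphs are finite, simple and undirected; a graph is non-trivial if it has at least two vertices. $G\,\square\,H$ denotes the Cartesian product: vertex set $V(G)\times V(H)$, with $(a,b)$ and $(c,d)$ adjacent iff $a=c$ and $bd\in E(H)$, or $ac\in E(G)$ and $b=d$. Swap number: a dominating set $D$ of a graph $G$ is a swap set if there is a dominating set $D'$ of $G$ with $D\cap D'=\emptyset$, $|D|=|D'|$, such that $G$ contains a perfect matching between $D$ and $D'$ (a bijection $f:D\to D'$ with $x f(x)\in E(G)$ for all $x\in D$). $DD_{\mathrm{m}}(G)$ is the minimum cardinality of a swap set of $G$, and $DD_{\mathrm{m}}(G)=\infty$ if none exists. *)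

theory Defs
  imports "Graph_Theory.Digraph_Component" "HOL-Library.Extended_Nat"
begin

text \<open>
  Finite simple undirected graphs are the symmetric loop-free digraphs given by the
  locale predicate \<^const>\<open>pair_graph\<close>: an edge \<open>uv\<close> is the pair of arcs \<open>(u,v)\<close>, \<open>(v,u)\<close>.
\<close>

definition nontrivial_graph :: "'a pair_pre_digraph \<Rightarrow> bool" where
  "nontrivial_graph G \<longleftrightarrow> card (pverts G) \<ge> 2"

text \<open>
  \<^const>\<open>tree\<close> and \<^const>\<open>spanning_tree\<close> are not usable for undirected graphs: in a symmetric
  digraph every edge \<open>uv\<close> yields the directed cycle \<open>u, v, u\<close>, so no graph with an edge
  would be a tree.  The cycles of a simple undirected graph are the directed cycles
  of length at least 3.
\<close>

definition undirected_tree :: "'a pair_pre_digraph \<Rightarrow> bool" where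
  "undirected_tree T \<longleftrightarrow> pair_graph T \<and> connected (with_proj T)
     \<and> \<not> (\<exists>p. pre_digraph.cycle (with_proj T) p \<and> length p \<ge> 3)"

definition undirected_spanning_tree :: "'a pair_pre_digraph \<Rightarrow> 'a pair_pre_digraph \<Rightarrow> bool" where
  "undirected_spanning_tree T G \<longleftrightarrow> undirected_tree T \<and> spanning (with_proj T) (with_proj G)"

definition cartesian_product ::
    "'a pair_pre_digraph \<Rightarrow> 'b pair_pre_digraph \<Rightarrow> ('a \<times> 'b) pair_pre_digraph" (infixl \<open>\<box>\<close> 70)
  where
  "G \<box> H = \<lparr> pverts = pverts G \<times> pverts H,
     parcs = {((a, b), (c, d)) | a b c d.
       (a \<in> pverts G \<and> a = c \<and> (b, d) \<in> parcs H) \<or>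
       ((a, c) \<in> parcs G \<and> b \<in> pverts H \<and> b = d)} \<rparr>"

definition dominating_set :: "'a pair_pre_digraph \<Rightarrow> 'a set \<Rightarrow> bool" where
  "dominating_set G D \<longleftrightarrow> D \<subseteq> pverts G \<and> (\<forall>v \<in> pverts G - D. \<exists>u \<in> D. (u, v) \<in> parcs G)"

definition swap_set :: "'a pair_pre_digraph \<Rightarrow> 'a set \<Rightarrow> bool" where
  "swap_set G D \<longleftrightarrow> dominating_set G D \<and>
     (\<exists>D'. dominating_set G D' \<and> D \<inter> D' = {} \<and> card D = card D' \<and>
       (\<exists>f. bij_betw f D D' \<and> (\<forall>x \<in> D. (x, f x) \<in> parcs G)))"

definition swap_number :: "'a pair_pre_digraph \<Rightarrow> enat" where
  "swap_number G = (INF D \<in> {D. swap_set G D}. enat (card D))"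

lemma swap_number_eq_infinity_iff: "swap_number G = \<infinity> \<longleftrightarrow> (\<nexists>D. swap_set G D)"
  by (simp add: swap_number_def INF_top_conv flip: top_enat_def) (simp add: top_enat_def)

lemma swap_number_attained:
  assumes "swap_set G D"
  shows "\<exists>D'. swap_set G D' \<and> swap_number G = enat (card D')"
proof -
  have "Inf ((\<lambda>D. enat (card D)) ` {D. swap_set G D}) \<in> (\<lambda>D. enat (card D)) ` {D. swap_set G D}"
    using assms by (intro wellorder_InfI) auto
  then show ?thesis
    unfolding swap_number_def by auto
qed

lemma pair_graph_cartesian_product:
  assumes "pair_graph G" "pair_graph H"
  shows "pair_graph (G \<box> H)"
proof -
  interpret G: pair_graph G by fact
  interpret H: pair_graph H by fact
  have *: "parcs (G \<box> H) \<subseteq> (pverts G \<times> pverts H) \<times> (pverts G \<times> pverts H)"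
    by (auto simp: cartesian_product_def dest: G.wellformed' H.wellformed')
  have sG: "(v, u) \<in> parcs G" if "(u, v) \<in> parcs G" for u v
    using arcs_ends_symmetric[OF G.pair_sym_arcs] that by simp
  have sH: "(v, u) \<in> parcs H" if "(u, v) \<in> parcs H" for u v
    using arcs_ends_symmetric[OF H.pair_sym_arcs] that by simp
  show ?thesis
  proof
    show "symmetric (with_proj (G \<box> H))"
      by (auto simp: symmetric_def sym_def cartesian_product_def intro: sG sH)
    show "finite (pverts (G \<box> H))"
      by (simp add: cartesian_product_def G.pair_finite_verts H.pair_finite_verts)
    show "finite (parcs (G \<box> H))"
      by (rule finite_subset[OF *]) (simp add: G.pair_finite_verts H.pair_finite_verts)
    show "fst e \<noteq> snd e" if "e \<in> parcs (G \<box> H)" for e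
      using that by (auto simp: cartesian_product_def dest: G.pair_no_loops H.pair_no_loops)
  qed (use * in \<open>force simp: cartesian_product_def\<close>)+
qed

end

theory Submission
  imports Defs
begin

text \<open>Domination and the matching ask only that certain edges be present, so a swap set
  survives when edges are added over a fixed vertex set (\<open>swap_set_add_arcs\<close>). The
  product of spanning subgraphs spans the product of the graphs
  (\<open>cartesian_product_mono\<close>), so each swap set of \<open>T \<box> T'\<close> is one of
  \<open>G \<box> H\<close>.\<close>

lemma dominating_set_add_arcs:
  assumes "dominating_set S D" "pverts S = pverts G" "parcs S \<subseteq> parcs G"
  shows "dominating_set G D"
  using assms unfolding dominating_set_def by blast

text \<open>The same partner set and the same bijection serve as witnesses in the larger
  graph.\<close>

lemma swap_set_add_arcs:
  assumes "swap_set S D" "pverts S = pverts G" "parcs S \<subseteq> parcs G"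
  shows "swap_set G D"
  using assms unfolding swap_set_def by (meson dominating_set_add_arcs subsetD)

text \<open>An infimum over a larger family is no larger. If \<open>S\<close> has no swap set, its
  infimum is \<infinity>, so this case needs no separate argument.\<close>

lemma swap_number_add_arcs:
  assumes "pverts S = pverts G" "parcs S \<subseteq> parcs G"
  shows "swap_number G \<le> swap_number S"
  unfolding swap_number_def using assms
  by (intro INF_superset_mono) (auto intro: swap_set_add_arcs)

lemma undirected_spanning_treeD:
  assumes "undirected_spanning_tree T G"
  shows "pverts T = pverts G" "parcs T \<subseteq> parcs G"
  using assms by (auto simp: undirected_spanning_tree_def spanning_def subgraph_def)

lemma cartesian_product_mono:
  assumes "pverts T = pverts G" "parcs T \<subseteq> parcs G"
    and "pverts T' = pverts H" "parcs T' \<subseteq> parcs H"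
  shows "pverts (T \<box> T') = pverts (G \<box> H)" "parcs (T \<box> T') \<subseteq> parcs (G \<box> H)"
  using assms by (auto simp: cartesian_product_def)

theorem corollary27:
  fixes G T :: "'a pair_pre_digraph" and H T' :: "'b pair_pre_digraph"
  assumes "pair_graph G" and "pair_graph H"
    and "nontrivial_graph G" and "nontrivial_graph H"
    and "undirected_spanning_tree T G" and "undirected_spanning_tree T' H"
  shows "swap_number (G \<box> H) \<le> swap_number (T \<box> T')"
  by (intro swap_number_add_arcs cartesian_product_mono undirected_spanning_treeD assms)

end
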